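(* Let $\Gamma$ be a non-trivial group generated by a finite symmetric subset $S = S^{-1} \subset \Gamma$, $\mathrm{Card}(S) < \infty$. For every finite non-empty subset $D \subset \Gamma$ such that $\mathrm{Card}(D) < \frac{\mathrm{Card}(\Gamma)}{2}$, we have $$\frac{\mathrm{Card}(\partial D)}{\mathrm{Card}(D)} > \frac{1}{2\cdot \phi_S(2\cdot \mathrm{Card}(D))}.$$
   Context: For $g \in \Gamma$, the word length $\|g\|$ (relative to $S$) is the minimal integer $n \geq 0$ such that $g$ is a product of $n$ elements of $S$. The identity element is $e$, and for $r \in \mathbb{N}$ ($\mathbb{N}$ contains $0$), $B(e,r) = \{g \in \Gamma : \|g\| \leq r\}$. The inverse growth function is $\phi_S(v) = \min\{r \in \mathbb{N} : \mathrm{Card}(B(e,r)) > v\}$ for $v \in \mathbb{N}$ (with $v<\mathrm{Card}(\Gamma)$ so that it is defined). $\Gamma$ carries the right-invariant word metric $\mathrm{dist}(x,y) = \|x y^{-1}\|$, and for a subset $D \subset \Gamma$ one sets $\mathrm{dist}(a,D) = \min_{b \in D} \mathrm{dist}(a,b)$ and $\partial D = \{a \in \Gamma : \mathrm{dist}(a,D) = 1\}$. If $\Gamma$ is infinite, the hypothesis $\mathrm{Card}(D) < \mathrm{Card}(\Gamma)/2$ holds automatically for every finite $D$. *)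

theory Defs
  imports Complex_Main "HOL-Algebra.Generated_Groups"
begin

text \<open>
  All notions are relative to a generating set \<open>S\<close> with \<open>S = S\<inverse>\<close>, so that every element of the
  group is a product of elements of \<open>S\<close> (without inverses); the empty product is the identity.
\<close>

definition word_length :: "('a, 'b) monoid_scheme \<Rightarrow> 'a set \<Rightarrow> 'a \<Rightarrow> nat" where
  "word_length G S g =
     (LEAST n. \<exists>ws. length ws = n \<and> set ws \<subseteq> S \<and> g = foldr (\<otimes>\<^bsub>G\<^esub>) ws \<one>\<^bsub>G\<^esub>)"

definition word_ball :: "('a, 'b) monoid_scheme \<Rightarrow> 'a set \<Rightarrow> nat \<Rightarrow> 'a set" where
  "word_ball G S r = {g \<in> carrier G. word_length G S g \<le> r}"

text \<open>
  Balls are finite when \<open>S\<close> is, so \<open>card\<close> is the true cardinality. The minimum exists precisely for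
  \<open>v\<close> below the cardinality of the group.
\<close>

definition inv_growth :: "('a, 'b) monoid_scheme \<Rightarrow> 'a set \<Rightarrow> nat \<Rightarrow> nat" where
  "inv_growth G S v = (LEAST r. card (word_ball G S r) > v)"

definition word_dist :: "('a, 'b) monoid_scheme \<Rightarrow> 'a set \<Rightarrow> 'a \<Rightarrow> 'a \<Rightarrow> nat" where
  "word_dist G S x y = word_length G S (x \<otimes>\<^bsub>G\<^esub> inv\<^bsub>G\<^esub> y)"

text \<open>The infimum of a non-empty set of natural numbers is its minimum.\<close>

definition word_setdist :: "('a, 'b) monoid_scheme \<Rightarrow> 'a set \<Rightarrow> 'a \<Rightarrow> 'a set \<Rightarrow> nat" where
  "word_setdist G S a D = (INF b\<in>D. word_dist G S a b)"

definition word_boundary :: "('a, 'b) monoid_scheme \<Rightarrow> 'a set \<Rightarrow> 'a set \<Rightarrow> 'a set" where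
  "word_boundary G S D = {a \<in> carrier G. word_setdist G S a D = 1}"

end

theory Submission
  imports Defs
begin

text \<open>
  If a word of length \<open>n\<close> moves a point of \<open>D\<close> out of \<open>D\<close>, then one of its \<open>n\<close> suffixes moves that
  point into the boundary; hence left translation by \<open>g\<close> moves at most \<open>\<parallel>g\<parallel> \<cdot> |\<partial>D|\<close> points of \<open>D\<close>
  out of \<open>D\<close>. On the other hand, for fixed \<open>x \<in> D\<close> at most \<open>|D|\<close> elements \<open>g\<close> satisfy \<open>g x \<in> D\<close>.
  So if a ball of radius \<open>r\<close> has more than \<open>2|D|\<close> elements, double counting the pairs \<open>(g, x)\<close> with
  \<open>g x \<notin> D\<close> over this ball gives \<open>r |\<partial>D| > |D| / 2\<close>.
\<close>

context group
begin

lemma foldr_mult_closed: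
  assumes "set ws \<subseteq> carrier G"
  shows "foldr (\<otimes>) ws \<one> \<in> carrier G"
  using assms by (induction ws) auto

lemma foldr_mult_append:
  assumes "set us \<subseteq> carrier G" "set vs \<subseteq> carrier G"
  shows "foldr (\<otimes>) (us @ vs) \<one> = foldr (\<otimes>) us \<one> \<otimes> foldr (\<otimes>) vs \<one>"
  using assms by (induction us) (auto simp: foldr_mult_closed m_assoc)

text \<open>\<open>generate\<close> also admits inverses of generators; symmetry of \<open>S\<close>
  makes each of them a generator again, so words without inverses suffice.\<close>

lemma generate_symmetric_word:
  assumes S: "S \<subseteq> carrier G" "set_inv S = S" and g: "g \<in> generate G S"
  shows "\<exists>ws. set ws \<subseteq> S \<and> g = foldr (\<otimes>) ws \<one>"
  using g
proof (induction rule: generate.induct)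
  case one
  show ?case by (rule exI[of _ "[]"]) simp
next
  case (incl h)
  then show ?case using S by (intro exI[of _ "[h]"]) auto
next
  case (inv h)
  then have "inv h \<in> S" using S(2) by (auto simp: SET_INV_def)
  then show ?case using S by (intro exI[of _ "[inv h]"]) auto
next
  case (eng h1 h2)
  then obtain us vs where "set us \<subseteq> S" "h1 = foldr (\<otimes>) us \<one>"
    "set vs \<subseteq> S" "h2 = foldr (\<otimes>) vs \<one>" by blast
  moreover from this have "foldr (\<otimes>) (us @ vs) \<one> = h1 \<otimes> h2"
    using S(1) foldr_mult_append[of us vs] by auto
  ultimately show ?case by (intro exI[of _ "us @ vs"]) auto
qed

lemma word_length_le:
  assumes "set ws \<subseteq> S"
  shows "word_length G S (foldr (\<otimes>) ws \<one>) \<le> length ws"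
  unfolding word_length_def by (rule Least_le) (use assms in blast)

text \<open>Existence of some word ensures that the \<open>LEAST\<close> in
  \<open>word_length\<close> is attained rather than unspecified.\<close>

lemma word_length_witness:
  assumes "S \<subseteq> carrier G" "set_inv S = S" "g \<in> generate G S"
  obtains ws where "length ws = word_length G S g" "set ws \<subseteq> S" "g = foldr (\<otimes>) ws \<one>"
proof -
  have "\<exists>n ws. length ws = n \<and> set ws \<subseteq> S \<and> g = foldr (\<otimes>) ws \<one>"
    using generate_symmetric_word[OF assms] by blast
  from LeastI_ex[OF this] show ?thesis
    using that unfolding word_length_def by blast
qed

lemma finite_word_ball:
  assumes "S \<subseteq> carrier G" "finite S" "set_inv S = S" "generate G S = carrier G"
  shows "finite (word_ball G S r)"
proof (rule finite_subset)
  show "word_ball G S r \<subseteq> (\<lambda>ws. foldr (\<otimes>) ws \<one>) ` {ws. set ws \<subseteq> S \<and> length ws \<le> r}"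
  proof
    fix g assume g: "g \<in> word_ball G S r"
    then have "g \<in> generate G S" using assms by (simp add: word_ball_def)
    then obtain ws where "length ws = word_length G S g" "set ws \<subseteq> S" "g = foldr (\<otimes>) ws \<one>"
      using word_length_witness[OF assms(1,3)] by metis
    then show "g \<in> (\<lambda>ws. foldr (\<otimes>) ws \<one>) ` {ws. set ws \<subseteq> S \<and> length ws \<le> r}"
      using g by (auto simp: word_ball_def)
  qed
qed (use assms finite_lists_length_le in blast)

text \<open>The \<open>LEAST\<close> in \<open>inv_growth\<close> is attained: a finite set with
  more than \<open>v\<close> elements lies in the ball whose radius is its largest word
  length.\<close>

lemma card_word_ball_inv_growth:
  assumes S: "S \<subseteq> carrier G" "finite S" "set_inv S = S" "generate G S = carrier G"
    and v: "finite (carrier G) \<Longrightarrow> v < card (carrier G)"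
  shows "v < card (word_ball G S (inv_growth G S v))"
proof -
  obtain F where F: "finite F" "F \<subseteq> carrier G" "v < card F"
  proof (cases "finite (carrier G)")
    case False
    then obtain F where "finite F" "card F = Suc v" "F \<subseteq> carrier G"
      using infinite_arbitrarily_large by blast
    then show ?thesis using that by simp
  qed (use v that in blast)
  define r where "r = Max (word_length G S ` F)"
  have "F \<subseteq> word_ball G S r"
    using F by (auto simp: word_ball_def r_def)
  then have "v < card (word_ball G S r)"
    using F(3) card_mono[OF finite_word_ball[OF S]] by (meson less_le_trans)
  then show ?thesis
    unfolding inv_growth_def by (rule LeastI)
qed

lemma word_dist_eq_0_imp_eq:
  assumes "S \<subseteq> carrier G" "set_inv S = S" "generate G S = carrier G"
    and "x \<in> carrier G" "y \<in> carrier G" "word_dist G S x y = 0"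
  shows "x = y"
proof -
  have "x \<otimes> inv y \<in> generate G S" using assms by simp
  then obtain ws where "length ws = word_length G S (x \<otimes> inv y)" "x \<otimes> inv y = foldr (\<otimes>) ws \<one>"
    using word_length_witness[OF assms(1,2)] by metis
  then have "x \<otimes> inv y = \<one>" using assms(6) by (auto simp: word_dist_def)
  then show ?thesis using assms(4,5) inv_equality[of x "inv y"] by simp
qed

text \<open>The metric is right-invariant, so left multiplication by a generator moves a point by
  distance at most 1, while a point outside \<open>D\<close> has distance at least 1 from
  \<open>D\<close>.\<close>

lemma mult_generator_in_word_boundary:
  assumes S: "S \<subseteq> carrier G" "set_inv S = S" "generate G S = carrier G"
    and D: "D \<subseteq> carrier G" and "s \<in> S" "d \<in> D" "s \<otimes> d \<notin> D"
  shows "s \<otimes> d \<in> word_boundary G S D"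
proof -
  have car: "s \<in> carrier G" "d \<in> carrier G" using assms by auto
  have "(s \<otimes> d) \<otimes> inv d = s" using car by (simp add: m_assoc)
  then have "word_dist G S (s \<otimes> d) d \<le> 1"
    using word_length_le[of "[s]" S] \<open>s \<in> S\<close> car by (simp add: word_dist_def)
  then have "word_setdist G S (s \<otimes> d) D \<le> 1"
    unfolding word_setdist_def using \<open>d \<in> D\<close> by (meson bdd_below_bot cINF_lower le_trans)
  moreover have "1 \<le> word_setdist G S (s \<otimes> d) D"
    unfolding word_setdist_def
  proof (rule cINF_greatest)
    fix b assume "b \<in> D"
    then have "word_dist G S (s \<otimes> d) b \<noteq> 0"
      using word_dist_eq_0_imp_eq[OF S, of "s \<otimes> d" b] D car \<open>s \<otimes> d \<notin> D\<close> by auto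
    then show "1 \<le> word_dist G S (s \<otimes> d) b" by simp
  qed (use \<open>d \<in> D\<close> in blast)
  ultimately show ?thesis using car by (simp add: word_boundary_def)
qed

text \<open>Each boundary point is a point of \<open>D\<close> multiplied on the left by an element
  of the unit ball. Finiteness excludes the default value 0 of \<open>card\<close>, so injecting
  into the boundary gives a genuine bound.\<close>

lemma finite_word_boundary:
  assumes S: "S \<subseteq> carrier G" "finite S" "set_inv S = S" "generate G S = carrier G"
    and D: "D \<subseteq> carrier G" "finite D" "D \<noteq> {}"
  shows "finite (word_boundary G S D)"
proof (rule finite_subset)
  show "word_boundary G S D \<subseteq> (\<lambda>(g, d). g \<otimes> d) ` (word_ball G S 1 \<times> D)"
  proof
    fix a assume a: "a \<in> word_boundary G S D"
    \<comment> \<open>The infimum of a non-empty set of naturals is attained, which provides a point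
      of \<open>D\<close> at distance exactly 1.\<close>
    have "word_setdist G S a D \<in> word_dist G S a ` D"
      unfolding word_setdist_def using D(3) by (intro Inf_nat_def1) simp
    then obtain d where d: "d \<in> D" "word_dist G S a d = 1"
      using a by (auto simp: word_boundary_def)
    have car: "a \<in> carrier G" "d \<in> carrier G" using a d D by (auto simp: word_boundary_def)
    then have "a \<otimes> inv d \<in> word_ball G S 1" "a = (a \<otimes> inv d) \<otimes> d"
      using d by (auto simp: word_ball_def word_dist_def m_assoc)
    then show "a \<in> (\<lambda>(g, d). g \<otimes> d) ` (word_ball G S 1 \<times> D)" using d by force
  qed
qed (use finite_word_ball[OF S] D in blast)

lemma card_translate_exit_le:
  assumes S: "S \<subseteq> carrier G" "finite S" "set_inv S = S" "generate G S = carrier G"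
    and D: "D \<subseteq> carrier G" "finite D" "D \<noteq> {}"
    and "set ws \<subseteq> S"
  shows "card {x \<in> D. foldr (\<otimes>) ws \<one> \<otimes> x \<notin> D} \<le> length ws * card (word_boundary G S D)"
  using \<open>set ws \<subseteq> S\<close>
proof (induction ws)
  case Nil
  have "{x \<in> D. foldr (\<otimes>) [] \<one> \<otimes> x \<notin> D} = {}" using D(1) by auto
  then show ?case by (simp only: card.empty)
next
  case (Cons s ws)
  define g where "g = foldr (\<otimes>) ws \<one>"
  have car: "s \<in> carrier G" "g \<in> carrier G" and "s \<in> S"
    using Cons.prems S(1) foldr_mult_closed[of ws] by (auto simp: g_def)
  let ?A = "{x \<in> D. g \<otimes> x \<notin> D}" and ?B = "{x \<in> D. (s \<otimes> g) \<otimes> x \<in> word_boundary G S D}"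
  \<comment> \<open>Either the suffix \<open>g\<close> has already moved \<open>x\<close> out of
    \<open>D\<close>, or \<open>g \<otimes> x\<close> is still in \<open>D\<close> and the letter
    \<open>s\<close> pushes it out, hence into the boundary.\<close>
  have "{x \<in> D. (s \<otimes> g) \<otimes> x \<notin> D} \<subseteq> ?A \<union> ?B"
  proof
    fix x assume x: "x \<in> {x \<in> D. (s \<otimes> g) \<otimes> x \<notin> D}"
    then have "(s \<otimes> g) \<otimes> x = s \<otimes> (g \<otimes> x)" using car D(1) m_assoc by blast
    then show "x \<in> ?A \<union> ?B"
      using x mult_generator_in_word_boundary[OF S(1,3,4) D(1) \<open>s \<in> S\<close>, of "g \<otimes> x"] by auto
  qed
  then have "card {x \<in> D. (s \<otimes> g) \<otimes> x \<notin> D} \<le> card (?A \<union> ?B)"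
    using D(2) by (intro card_mono) auto
  also have "\<dots> \<le> card ?A + card ?B" by (rule card_Un_le)
  also have "card ?A \<le> length ws * card (word_boundary G S D)"
    using Cons by (simp add: g_def)
  also have "card ?B \<le> card (word_boundary G S D)"
  proof (rule card_inj_on_le)
    show "inj_on (\<lambda>x. (s \<otimes> g) \<otimes> x) ?B"
      using car D(1) by (intro inj_onI) (auto simp: subset_iff)
  qed (use finite_word_boundary[OF S D] in auto)
  finally show ?case by (simp add: g_def)
qed

text \<open>The double counting, free of division and for any sufficiently large ball, so that the
  choice of radius stays separate.\<close>

lemma card_less_radius_times_boundary:
  assumes S: "S \<subseteq> carrier G" "finite S" "set_inv S = S" "generate G S = carrier G"
    and D: "D \<subseteq> carrier G" "finite D" "D \<noteq> {}"
    and r: "2 * card D < card (word_ball G S r)"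
  shows "card D < 2 * r * card (word_boundary G S D)"
proof -
  let ?B = "word_ball G S r" and ?b = "card (word_boundary G S D)"
  have fB: "finite ?B" by (rule finite_word_ball[OF S])
  have exit: "card {x \<in> D. g \<otimes> x \<notin> D} \<le> r * ?b" if g: "g \<in> ?B" for g
  proof -
    have "g \<in> generate G S" using g S by (simp add: word_ball_def)
    then obtain ws where ws: "length ws = word_length G S g" "set ws \<subseteq> S" "g = foldr (\<otimes>) ws \<one>"
      using word_length_witness[OF S(1,3)] by metis
    then have "card {x \<in> D. g \<otimes> x \<notin> D} \<le> length ws * ?b"
      using card_translate_exit_le[OF S D] by blast
    also have "\<dots> \<le> r * ?b" using g ws by (auto simp: word_ball_def)
    finally show ?thesis .
  qed
  have stay: "card {g \<in> ?B. g \<otimes> x \<in> D} \<le> card D" if "x \<in> D" for x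
  proof (rule card_inj_on_le)
    show "inj_on (\<lambda>g. g \<otimes> x) {g \<in> ?B. g \<otimes> x \<in> D}"
      using that D(1) by (intro inj_onI) (auto simp: word_ball_def subset_iff)
  qed (use D in auto)
  have "card ?B * card D = (\<Sum>g\<in>?B. card {x \<in> D. g \<otimes> x \<notin> D} + card {x \<in> D. g \<otimes> x \<in> D})"
  proof -
    have "card {x \<in> D. g \<otimes> x \<notin> D} + card {x \<in> D. g \<otimes> x \<in> D} = card D" for g
      using D(2) by (subst card_Un_disjoint[symmetric]) (auto intro: arg_cong[where f = card])
    then show ?thesis by simp
  qed
  \<comment> \<open>Only the pairs with \<open>g \<otimes> x \<in> D\<close> are recounted by
    \<open>x\<close>; the exits stay grouped by \<open>g\<close>, where \<open>exit\<close> bounds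
    them.\<close>
  also have "\<dots> = (\<Sum>g\<in>?B. card {x \<in> D. g \<otimes> x \<notin> D}) + (\<Sum>x\<in>D. card {g \<in> ?B. g \<otimes> x \<in> D})"
    using sum.swap_restrict[OF fB D(2), of "\<lambda>_ _. 1::nat" "\<lambda>g x. g \<otimes> x \<in> D"]
    by (simp add: sum.distrib)
  also have "\<dots> \<le> card ?B * (r * ?b) + card D * card D"
    using sum_bounded_above[of ?B, OF exit] sum_bounded_above[of D, OF stay]
    by (intro add_mono) auto
  finally have le: "card ?B * card D \<le> card ?B * (r * ?b) + card D * card D" .
  have "0 < card D" using D by (simp add: card_gt_0_iff)
  \<comment> \<open>The term \<open>card D * card D\<close> is less than half of the left side of
    \<open>le\<close>, so the exits account for more than half; cancelling \<open>card ?B\<close>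
    then finishes.\<close>
  then have "2 * card D * card D < card ?B * card D" using r by simp
  with le have "card ?B * card D < 2 * (card ?B * (r * ?b))" by linarith
  then have "card ?B * card D < card ?B * (2 * r * ?b)" by (simp only: ac_simps)
  then show ?thesis by simp
qed

end

theorem theorem1p1:
  fixes G :: "('a, 'b) monoid_scheme" and S D :: "'a set"
  assumes "group G"
    and "carrier G \<noteq> {\<one>\<^bsub>G\<^esub>}"
    and "S \<subseteq> carrier G"
    and "finite S"
    and "set_inv\<^bsub>G\<^esub> S = S"
    and "generate G S = carrier G"
    and "D \<subseteq> carrier G"
    and "finite D"
    and "D \<noteq> {}"
    and "finite (carrier G) \<Longrightarrow> real (card D) < real (card (carrier G)) / 2"
  shows "real (card (word_boundary G S D)) / real (card D)
           > 1 / (2 * real (inv_growth G S (2 * card D)))"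
proof -
  interpret group G by fact
  note S = \<open>S \<subseteq> carrier G\<close> \<open>finite S\<close> \<open>set_inv\<^bsub>G\<^esub> S = S\<close> \<open>generate G S = carrier G\<close>
  let ?r = "inv_growth G S (2 * card D)" and ?b = "card (word_boundary G S D)"
  \<comment> \<open>For a finite group the hypothesis on \<open>D\<close> says that
    \<open>2 * card D\<close> is below the group order, so the radius is well defined; an infinite
    group imposes no bound.\<close>
  have "2 * card D < card (word_ball G S ?r)"
    by (rule card_word_ball_inv_growth[OF S]) (use assms(10) in force)
  then have *: "card D < 2 * ?r * ?b"
    using card_less_radius_times_boundary[OF S] assms by blast
  \<comment> \<open>Radius 0 would turn the previous bound into \<open>card D < 0\<close>; so the
    final quotient does not rest on the convention \<open>1 / 0 = 0\<close>.\<close>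
  then have "0 < ?r" by (cases "?r = 0") auto
  moreover have "0 < card D" using assms by (simp add: card_gt_0_iff)
  moreover have "real (card D) < 2 * real ?r * real ?b"
    using * by (metis of_nat_less_iff of_nat_mult of_nat_numeral)
  ultimately show ?thesis by (simp add: field_simps)
qed

end
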